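(* Let $\mathcal{A}_1,\dots,\mathcal{A}_d\in\mathbb{R}^{n_1\times n_2\times n_3}$ be linearly independent, let $\mathscr{A}(\mathcal{T})=(\langle\mathcal{A}_1,\mathcal{T}\rangle,\dots,\langle\mathcal{A}_d,\mathcal{T}\rangle)\in\mathbb{R}^d$, let $\mathbf{b}\in\mathbb{R}^d$, and assume $\{\mathcal{T}:\mathscr{A}(\mathcal{T})=\mathbf{b}\}\neq\emptyset$. Let $\mathcal{T}^*$ be an optimal solution of $$\min_{\mathcal{T}\in\mathbb{R}^{n_1\times n_2\times n_3}}\{\|\mathcal{T}\|_*:\mathscr{A}(\mathcal{T})=\mathbf{b}\}.$$ Let $\tau\in(0,1]$ and let $\Upsilon=\{\mathbf{x}_1,\dots,\mathbf{x}_m\}\subseteq\mathbb{B}^{n_1}$ be a $\tau$-hitting set. Let $(\widehat{\mathcal{T}},\{\widehat\Lambda_i\}_{i=1}^m)$ be an optimal solution, and $\widehat V$ the optimal value, of the problem $$\min_{\mathcal{T},\Lambda_1,\dots,\Lambda_m}\ \frac12\sum_{i=1}^m\operatorname{tr}(\Lambda_i)\quad\text{s.t.}\quad \Lambda_i=\begin{bmatrix}\Lambda_i^{(1)}&\Gamma_i\\ \Gamma_i^\top&\Lambda_i^{(2)}\end{bmatrix}\succeq 0\ (i=1,\dots,m),\quad \mathcal{T}=\sum_{i=1}^m\mathbf{x}_i\otimes\Gamma_i,\quad \mathscr{A}(\mathcal{T})=\mathbf{b},$$ where $\Lambda_i$ is symmetric with blocks $\Lambda_i^{(1)}\in\mathbb{R}^{n_2\times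 n_2}$, $\Gamma_i\in\mathbb{R}^{n_2\times n_3}$, $\Lambda_i^{(2)}\in\mathbb{R}^{n_3\times n_3}$. Then $$\tau\widehat V\le\|\widehat{\mathcal{T}}\|_*\le\widehat V\qquad\text{and}\qquad \tau\|\widehat{\mathcal{T}}\|_*\le\|\mathcal{T}^*\|_*\le\|\widehat{\mathcal{T}}\|_*.$$
   Context: $\mathbb{B}^{n}=\{\mathbf{x}\in\mathbb{R}^n:\|\mathbf{x}\|=1\}$ is the Euclidean unit sphere; $\langle\cdot,\cdot\rangle$ is the entrywise (Frobenius) inner product; $(\mathbf{x}\otimes\Gamma)(j_1,j_2,j_3)=x_{j_1}\Gamma(j_2,j_3)$ for $\mathbf{x}\in\mathbb{R}^{n_1}$, $\Gamma\in\mathbb{R}^{n_2\times n_3}$. A finite set $\Upsilon=\{\mathbf{x}_1,\dots,\mathbf{x}_m\}\subseteq\mathbb{B}^{n_1}$ is a $\tau$-hitting set if $\bigcup_{i=1}^m\{\mathbf{y}\in\mathbb{B}^{n_1}:\mathbf{y}^\top\mathbf{x}_i\ge\tau\}=\mathbb{B}^{n_1}$. The tensor nuclear norm of $\mathcal{T}\in\mathbb{R}^{n_1\times n_2\times n_3}$ is $$\|\mathcal{T}\|_*=\min\left\{\sum_{r=1}^R|\lambda_r|:\ \mathcal{T}=\sum_{r=1}^R\lambda_r\,\mathbf{x}_1^{(r)}\otimes\mathbf{x}_2^{(r)}\otimes\mathbf{x}_3^{(r)},\ R\in\mathbb{N},\ \lambda_r\in\mathbb{R},\ \mathbf{x}_\ell^{(r)}\in\mathbb{R}^{n_\ell},\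 \|\mathbf{x}_\ell^{(r)}\|=1\ \forall \ell,r\right\}.$$ *)

theory Defs
  imports "HOL-Analysis.Analysis"
begin

text \<open>
  A third-order tensor in \<open>\<real>\<^sup>n\<^sup>1\<^sup>\<times>\<^sup>n\<^sup>2\<^sup>\<times>\<^sup>n\<^sup>3\<close> is a nested vector, with entry \<open>T $ j\<^sub>1 $ j\<^sub>2 $ j\<^sub>3\<close>. The inner
  product that the library puts on this type is the entrywise one, see \<open>inner_tensor\<close>.
\<close>

type_synonym ('n1, 'n2, 'n3) tensor = "(((real, 'n3) vec, 'n2) vec, 'n1) vec"

lemma inner_tensor:
  fixes S T :: "('n1::finite, 'n2::finite, 'n3::finite) tensor"
  shows "S \<bullet> T = (\<Sum>j1\<in>UNIV. \<Sum>j2\<in>UNIV. \<Sum>j3\<in>UNIV. S $ j1 $ j2 $ j3 * T $ j1 $ j2 $ j3)"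
  by (simp add: inner_vec_def)

text \<open>
  The second factor is polymorphic, so that \<open>outer\<close> covers both vector times matrix and vector
  times vector; \<open>x \<otimes> y \<otimes> z\<close> is \<open>outer x (outer y z)\<close>.
\<close>

definition outer :: "real ^ 'n \<Rightarrow> 'a::real_vector \<Rightarrow> 'a ^ 'n" where
  "outer x Y = (\<chi> j. x $ j *\<^sub>R Y)"

lemma outer_vec_mat_nth: "outer x \<Gamma> $ j1 $ j2 $ j3 = x $ j1 * \<Gamma> $ j2 $ j3"
  for \<Gamma> :: "real ^ 'n3 ^ 'n2"
  by (simp add: outer_def)

lemma outer_vec_vec_vec_nth: "outer x (outer y z) $ j1 $ j2 $ j3 = x $ j1 * y $ j2 * z $ j3"
  for z :: "real ^ 'n3"
  by (simp add: outer_def)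

definition hitting_set :: "real \<Rightarrow> (real ^ 'n) set \<Rightarrow> bool" where
  "hitting_set \<tau> \<Upsilon> \<longleftrightarrow>
     finite \<Upsilon> \<and> \<Upsilon> \<subseteq> sphere 0 1 \<and> (\<Union>x\<in>\<Upsilon>. {y \<in> sphere 0 1. y \<bullet> x \<ge> \<tau>}) = sphere 0 1"

text \<open>
  The minimum in the definition of the nuclear norm is written as an infimum; the set is nonempty
  and bounded below by 0, so the two agree whenever the minimum is attained.
\<close>

definition nuclear_norm :: "('n1::finite, 'n2::finite, 'n3::finite) tensor \<Rightarrow> real" where
  "nuclear_norm T =
     Inf {(\<Sum>r<R. \<bar>c r\<bar>) | (R :: nat) (c :: nat \<Rightarrow> real) u v w.
            T = (\<Sum>r<R. c r *\<^sub>R outer (u r) (outer (v r) (w r))) \<and>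
            (\<forall>r<R. norm (u r) = 1 \<and> norm (v r) = 1 \<and> norm (w r) = 1)}"

definition meas_map ::
  "('d \<Rightarrow> ('n1::finite, 'n2::finite, 'n3::finite) tensor) \<Rightarrow> ('n1, 'n2, 'n3) tensor \<Rightarrow> real ^ 'd" where
  "meas_map A T = (\<chi> k. A k \<bullet> T)"

definition psd :: "real ^ 'n ^ 'n \<Rightarrow> bool" where
  "psd M \<longleftrightarrow> transpose M = M \<and> (\<forall>v. v \<bullet> (M *v v) \<ge> 0)"

fun block_entry ::
  "real ^ 'p ^ 'p \<Rightarrow> real ^ 'q ^ 'p \<Rightarrow> real ^ 'p ^ 'q \<Rightarrow> real ^ 'q ^ 'q \<Rightarrow> 'p + 'q \<Rightarrow> 'p + 'q \<Rightarrow> real" where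
  "block_entry P Q R S (Inl i) (Inl j) = P $ i $ j"
| "block_entry P Q R S (Inl i) (Inr j) = Q $ i $ j"
| "block_entry P Q R S (Inr i) (Inl j) = R $ i $ j"
| "block_entry P Q R S (Inr i) (Inr j) = S $ i $ j"

definition block_matrix ::
  "real ^ 'p ^ 'p \<Rightarrow> real ^ 'q ^ 'p \<Rightarrow> real ^ 'p ^ 'q \<Rightarrow> real ^ 'q ^ 'q \<Rightarrow> real ^ ('p + 'q) ^ ('p + 'q)" where
  "block_matrix P Q R S = (\<chi> i j. block_entry P Q R S i j)"

definition sdp_feasible ::
  "('d \<Rightarrow> ('n1::finite, 'n2::finite, 'n3::finite) tensor) \<Rightarrow> real ^ 'd \<Rightarrow> ('m::finite \<Rightarrow> real ^ 'n1) \<Rightarrow>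
   ('n1, 'n2, 'n3) tensor \<times> ('m \<Rightarrow> real ^ ('n2 + 'n3) ^ ('n2 + 'n3)) \<Rightarrow> bool" where
  "sdp_feasible A b x = (\<lambda>(T, \<Lambda>).
     \<exists>\<Lambda>1 \<Gamma> \<Lambda>2.
       (\<forall>i. \<Lambda> i = block_matrix (\<Lambda>1 i) (\<Gamma> i) (transpose (\<Gamma> i)) (\<Lambda>2 i) \<and> psd (\<Lambda> i)) \<and>
       T = (\<Sum>i\<in>UNIV. outer (x i) (\<Gamma> i)) \<and>
       meas_map A T = b)"

definition sdp_objective ::
  "('n1::finite, 'n2::finite, 'n3::finite) tensor \<times> ('m::finite \<Rightarrow> real ^ ('n2 + 'n3) ^ ('n2 + 'n3)) \<Rightarrow> real"
  where
  "sdp_objective = (\<lambda>(T, \<Lambda>). 1/2 * (\<Sum>i\<in>UNIV. trace (\<Lambda> i)))"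

definition sdp_value ::
  "('d \<Rightarrow> ('n1::finite, 'n2::finite, 'n3::finite) tensor) \<Rightarrow> real ^ 'd \<Rightarrow> ('m::finite \<Rightarrow> real ^ 'n1) \<Rightarrow> real"
  where
  "sdp_value A b x = (INF p \<in> Collect (sdp_feasible A b x). sdp_objective p)"

end

theory Submission
  imports Defs
begin

text \<open>
  Two facts carry the proof. A positive semidefinite block matrix is a sum of rank-one matrices
  \<open>g g\<^sup>T\<close> with \<open>g = (p, q)\<close>, so that its off-diagonal block is \<open>\<Sum> p q\<^sup>T\<close> and half its trace is
  \<open>\<Sum> (|p|\<^sup>2 + |q|\<^sup>2) / 2 \<ge> \<Sum> |p| |q|\<close>; hence the semidefinite objective dominates the nuclear norm.
  Conversely, by separation of convex sets, a \<open>\<tau>\<close>-hitting set has the ball of radius \<open>\<tau>\<close> in its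
  convex hull, so replacing every first factor of a rank-one decomposition by \<open>1/\<tau>\<close> times a convex
  combination of the hitting set gives a semidefinite feasible point whose objective is larger than
  the weight of the decomposition by a factor of at most \<open>1/\<tau>\<close>.
\<close>

section \<open>Outer products and sums of rank-one matrices\<close>

lemma linear_outer_right: "linear (outer x)"
  by (rule linearI) (simp_all add: outer_def vec_eq_iff scaleR_right_distrib)

lemma linear_outer_left: "linear (\<lambda>x. outer x Y)"
  by (rule linearI) (simp_all add: outer_def vec_eq_iff scaleR_left_distrib)

lemma outer_mult_vec: "outer g h *v v = (h \<bullet> v) *\<^sub>R g"
  by (simp add: outer_def vec_eq_iff matrix_vector_mult_def inner_vec_def sum_distrib_left mult_ac)

lemma sum_mult_vec: "(\<Sum>k\<in>I. M k) *v v = (\<Sum>k\<in>I. M k *v v)"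
  for M :: "'i \<Rightarrow> real ^ 'n ^ 'm"
  by (induction I rule: infinite_finite_induct) (simp_all add: matrix_vector_mult_add_rdistrib)

lemma psd_sum_outer: "psd (\<Sum>k\<in>I. outer (g k) (g k))"
  unfolding psd_def
proof (intro conjI allI)
  show "transpose (\<Sum>k\<in>I. outer (g k) (g k)) = (\<Sum>k\<in>I. outer (g k) (g k))"
    by (simp add: transpose_def vec_eq_iff outer_def mult_ac)
  show "v \<bullet> ((\<Sum>k\<in>I. outer (g k) (g k)) *v v) \<ge> 0" for v
    by (simp add: sum_mult_vec outer_mult_vec inner_sum_right inner_commute[of v] sum_nonneg)
qed

lemma trace_sum_outer: "trace (\<Sum>k\<in>I. outer (g k) (g k)) = (\<Sum>k\<in>I. (norm (g k))\<^sup>2)"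
  by (simp add: trace_def outer_def power2_norm_eq_inner inner_vec_def sum.swap[of _ UNIV])

section \<open>Rank-one factorization of positive semidefinite matrices\<close>

text \<open>The quadratic form at \<open>v - t *\<^sub>R w\<close> is a polynomial in
  \<open>t\<close> that is nowhere negative; a suitable \<open>t\<close> yields the inequality.
  Definiteness is not assumed, so the leading coefficient may vanish.\<close>

lemma psd_Cauchy_Schwarz:
  assumes "psd M"
  shows "(v \<bullet> (M *v w))\<^sup>2 \<le> (v \<bullet> (M *v v)) * (w \<bullet> (M *v w))"
proof -
  define a s m where "a = v \<bullet> (M *v v)" and "s = v \<bullet> (M *v w)" and "m = w \<bullet> (M *v w)"
  have sym: "w \<bullet> (M *v v) = s"
    using assms unfolding psd_def s_def
    by (metis dot_lmul_matrix inner_commute transpose_matrix_vector)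
  have quad: "0 \<le> a - 2 * t * s + t\<^sup>2 * m" for t
  proof -
    have "0 \<le> (v - t *\<^sub>R w) \<bullet> (M *v (v - t *\<^sub>R w))"
      using assms by (simp add: psd_def)
    also have "\<dots> = a - 2 * t * s + t\<^sup>2 * m"
      using sym unfolding a_def s_def m_def
      by (simp add: matrix_vector_mult_diff_distrib matrix_vector_mult_scaleR inner_diff
          algebra_simps power2_eq_square)
    finally show ?thesis .
  qed
  have "m \<ge> 0" using assms by (simp add: psd_def m_def)
  then consider "m > 0" | "m = 0" by linarith
  then have "s\<^sup>2 \<le> a * m"
  proof cases
    case 1
    \<comment> \<open>\<open>s / m\<close> is the minimizer of the quadratic polynomial.\<close>
    with quad[of "s / m"] show ?thesis
      by (simp add: field_simps power2_eq_square)
  next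
    case 2
    \<comment> \<open>For \<open>m = 0\<close> the polynomial is the affine function
      \<open>a - 2 * t * s\<close>; if \<open>s\<close> were nonzero, this \<open>t\<close> would
      give it the value -1.\<close>
    with quad[of "(a + 1) / (2 * s)"] show ?thesis
      by (cases "s = 0") auto
  qed
  then show ?thesis by (simp add: a_def s_def m_def)
qed

lemma axis_mult_vec:
  fixes M :: "real ^ 'n ^ 'm"
  shows "axis i 1 \<bullet> (M *v axis j 1) = M $ i $ j"
  by (simp add: inner_axis' matrix_vector_mul_component inner_axis)

text \<open>
  Cholesky elimination: subtracting the rank-one matrix that clears one row lowers the number of
  nonzero diagonal entries.
\<close>

lemma psd_imp_sum_outer:
  fixes M :: "real ^ 'n ^ 'n"
  assumes "psd M"
  shows "\<exists>(R::nat) g. M = (\<Sum>k<R. outer (g k) (g k))"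
  using assms
proof (induction "card {i. M $ i $ i \<noteq> 0}" arbitrary: M rule: less_induct)
  case less
  \<comment> \<open>A vanishing diagonal entry thus forces its whole row and column to vanish. This
    settles the base case and later keeps zero diagonal entries at zero.\<close>
  have CS: "(M $ i $ j)\<^sup>2 \<le> M $ i $ i * M $ j $ j" for i j
    using psd_Cauchy_Schwarz[OF less.prems, of "axis i 1" "axis j 1"] by (simp add: axis_mult_vec)
  show ?case
  proof (cases "\<forall>i. M $ i $ i = 0")
    case True
    then have "M = 0"
      using CS by (simp add: vec_eq_iff)
    then have "M = (\<Sum>k<(0::nat). outer (g k) (g k))" for g
      by simp
    then show ?thesis by blast
  next
    case False
    then obtain i where i: "M $ i $ i \<noteq> 0" by blast
    define m where "m = M $ i $ i"
    have "m \<ge> 0"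
      using less.prems axis_mult_vec[of i M i] by (metis m_def psd_def)
    with i have m: "m > 0" by (simp add: m_def)
    \<comment> \<open>Column \<open>i\<close> of \<open>M\<close>, scaled so that
      \<open>outer h h\<close> agrees with \<open>M\<close> in row and column
      \<open>i\<close>.\<close>
    define h where "h = (1 / sqrt m) *\<^sub>R (M *v axis i 1)"
    have h_nth: "h $ j = M $ j $ i / sqrt m" for j
      by (simp add: h_def matrix_vector_mul_component inner_axis)
    define M' where "M' = M - outer h h"
    have "psd M'"
      unfolding psd_def
    proof (intro conjI allI)
      have "transpose M = M" using less.prems by (simp add: psd_def)
      then show "transpose M' = M'"
        by (simp add: M'_def transpose_def vec_eq_iff outer_def mult_ac)
      fix v
      \<comment> \<open>Semidefiniteness survives the subtraction because Cauchy-Schwarz against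
        \<open>axis i 1\<close> bounds exactly the amount removed from the quadratic form.\<close>
      have "(v \<bullet> h)\<^sup>2 = (v \<bullet> (M *v axis i 1))\<^sup>2 / m"
        using m by (simp add: h_def power_mult_distrib power_divide)
      also have "\<dots> \<le> v \<bullet> (M *v v)"
        using psd_Cauchy_Schwarz[OF less.prems, of v "axis i 1"] m
        by (simp add: axis_mult_vec m_def field_simps)
      finally show "v \<bullet> (M' *v v) \<ge> 0"
        by (simp add: M'_def matrix_vector_mult_diff_rdistrib outer_mult_vec inner_diff
            inner_commute power2_eq_square)
    qed
    moreover have "card {j. M' $ j $ j \<noteq> 0} < card {j. M $ j $ j \<noteq> 0}"
    proof (rule psubset_card_mono)
      have diag: "M' $ j $ j = M $ j $ j - (M $ j $ i)\<^sup>2 / m" for j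
        using m by (simp add: M'_def outer_def h_nth power2_eq_square)
      have "M' $ i $ i = 0"
        using m by (simp add: diag m_def power2_eq_square)
      moreover have "M' $ j $ j = 0" if "M $ j $ j = 0" for j
        using that CS[of j i] by (simp add: diag)
      ultimately show "{j. M' $ j $ j \<noteq> 0} \<subset> {j. M $ j $ j \<noteq> 0}"
        using i by blast
    qed simp
    ultimately obtain R :: nat and g where g: "M' = (\<Sum>k<R. outer (g k) (g k))"
      using less.hyps by blast
    have "M = (\<Sum>k<Suc R. outer ((g(R := h)) k) ((g(R := h)) k))"
      using g by (simp add: M'_def algebra_simps)
    then show ?thesis by blast
  qed
qed

section \<open>Stacked vectors and block matrices\<close>

definition join_vec :: "real ^ 'p \<Rightarrow> real ^ 'q \<Rightarrow> real ^ ('p + 'q)" where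
  "join_vec p q = (\<chi> i. case i of Inl a \<Rightarrow> p $ a | Inr b \<Rightarrow> q $ b)"

lemma join_vec_surj: "\<exists>p q. g = join_vec p q"
proof
  show "\<exists>q. g = join_vec (\<chi> a. g $ Inl a) q"
    by (rule exI[of _ "\<chi> b. g $ Inr b"]) (simp add: join_vec_def vec_eq_iff split: sum.split)
qed

lemma norm_join_vec: "(norm (join_vec p q))\<^sup>2 = (norm p)\<^sup>2 + (norm q)\<^sup>2"
proof -
  have "(norm (join_vec p q))\<^sup>2 = (\<Sum>i\<in>UNIV <+> UNIV. join_vec p q $ i * join_vec p q $ i)"
    by (simp add: power2_norm_eq_inner inner_vec_def)
  also have "\<dots> = (norm p)\<^sup>2 + (norm q)\<^sup>2"
    by (subst sum.Plus) (simp_all add: power2_norm_eq_inner inner_vec_def join_vec_def)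
  finally show ?thesis .
qed

text \<open>Puts a Gram sum of stacked vectors into the block form that \<open>sdp_feasible\<close>
  demands.\<close>

lemma sum_outer_join_vec:
  "(\<Sum>k\<in>I. outer (join_vec (p k) (q k)) (join_vec (p k) (q k))) =
     block_matrix (\<Sum>k\<in>I. outer (p k) (p k)) (\<Sum>k\<in>I. outer (p k) (q k))
       (transpose (\<Sum>k\<in>I. outer (p k) (q k))) (\<Sum>k\<in>I. outer (q k) (q k))"
  (is "?L = ?R")
proof -
  have "?L $ i $ j = ?R $ i $ j" for i j
    by (cases i; cases j)
       (simp_all add: block_matrix_def outer_def join_vec_def transpose_def mult_ac)
  then show ?thesis by (simp add: vec_eq_iff)
qed

text \<open>Cut every vector of a rank-one factorization of the block matrix into its two parts: the
  upper right block collects the mixed products, and the trace collects the squared norms.\<close>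

lemma psd_block_matrix_factor:
  assumes "psd (block_matrix P Q (transpose Q) S)"
  obtains R :: nat and p q where "Q = (\<Sum>k<R. outer (p k) (q k))"
    and "trace (block_matrix P Q (transpose Q) S) = (\<Sum>k<R. (norm (p k))\<^sup>2 + (norm (q k))\<^sup>2)"
proof -
  obtain R :: nat and g
    where g: "block_matrix P Q (transpose Q) S = (\<Sum>k<R. outer (g k) (g k))"
    using psd_imp_sum_outer[OF assms] by blast
  have "\<forall>k. \<exists>pq. g k = join_vec (fst pq) (snd pq)"
    using join_vec_surj by (metis fst_conv snd_conv)
  then obtain pq where pq: "\<And>k. g k = join_vec (fst (pq k)) (snd (pq k))"
    by metis
  define p q where "p k = fst (pq k)" and "q k = snd (pq k)" for k
  have gk: "g k = join_vec (p k) (q k)" for k by (simp add: p_def q_def pq)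
  have "Q $ a $ b = (\<Sum>k<R. outer (p k) (q k)) $ a $ b" for a b
  proof -
    have "Q $ a $ b = block_matrix P Q (transpose Q) S $ Inl a $ Inr b"
      by (simp add: block_matrix_def)
    also have "\<dots> = (\<Sum>k<R. outer (p k) (q k)) $ a $ b"
      unfolding g gk by (simp add: outer_def join_vec_def)
    finally show ?thesis .
  qed
  then have "Q = (\<Sum>k<R. outer (p k) (q k))" by (simp add: vec_eq_iff)
  moreover have
    "trace (block_matrix P Q (transpose Q) S) = (\<Sum>k<R. (norm (p k))\<^sup>2 + (norm (q k))\<^sup>2)"
    by (simp add: g trace_sum_outer gk norm_join_vec)
  ultimately show ?thesis using that by blast
qed

section \<open>Rank-one decompositions and the nuclear norm\<close>

definition decomposition_weights :: "('n1::finite, 'n2::finite, 'n3::finite) tensor \<Rightarrow> real set" where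
  "decomposition_weights T =
     {(\<Sum>r<R. \<bar>c r\<bar>) | (R :: nat) (c :: nat \<Rightarrow> real) u v w.
        T = (\<Sum>r<R. c r *\<^sub>R outer (u r) (outer (v r) (w r))) \<and>
        (\<forall>r<R. norm (u r) = 1 \<and> norm (v r) = 1 \<and> norm (w r) = 1)}"

lemma nuclear_norm_eq: "nuclear_norm T = Inf (decomposition_weights T)"
  unfolding nuclear_norm_def decomposition_weights_def ..

text \<open>A zero vector is given an arbitrary axis as its direction, since decompositions require
  unit factors even in vanishing terms.\<close>

lemma polar_decomposition:
  fixes f :: "'i \<Rightarrow> real ^ 'n"
  obtains y where "\<And>i. norm (y i) = 1" "\<And>i. f i = norm (f i) *\<^sub>R y i"
proof
  let ?y = "\<lambda>i. if f i = 0 then axis undefined 1 else sgn (f i)"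
  show "norm (?y i) = 1" "f i = norm (f i) *\<^sub>R ?y i" for i
    by (simp_all add: norm_axis_1 norm_sgn sgn_div_norm)
qed

lemma decomposition_weight_sum:
  assumes "finite I"
  shows "(\<Sum>i\<in>I. norm (u i) * (norm (v i) * norm (w i)))
    \<in> decomposition_weights (\<Sum>i\<in>I. outer (u i) (outer (v i) (w i)))"
proof -
  obtain u' where u': "\<And>i. norm (u' i) = 1" "\<And>i. u i = norm (u i) *\<^sub>R u' i"
    using polar_decomposition by blast
  obtain v' where v': "\<And>i. norm (v' i) = 1" "\<And>i. v i = norm (v i) *\<^sub>R v' i"
    using polar_decomposition by blast
  obtain w' where w': "\<And>i. norm (w' i) = 1" "\<And>i. w i = norm (w i) *\<^sub>R w' i"
    using polar_decomposition by blast
  define c where "c i = norm (u i) * (norm (v i) * norm (w i))" for i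
  have eq: "outer (u i) (outer (v i) (w i)) = c i *\<^sub>R outer (u' i) (outer (v' i) (w' i))" for i
  proof -
    have "outer (u i) (outer (v i) (w i)) =
        outer (norm (u i) *\<^sub>R u' i) (outer (norm (v i) *\<^sub>R v' i) (norm (w i) *\<^sub>R w' i))"
      using u' v' w' by metis
    also have "\<dots> = c i *\<^sub>R outer (u' i) (outer (v' i) (w' i))"
      by (simp add: outer_def vec_eq_iff c_def)
    finally show ?thesis .
  qed
  obtain e where e: "bij_betw e {..<card I} I"
    using ex_bij_betw_nat_finite[OF assms] by (auto simp: atLeast0LessThan)
  have "(\<Sum>i\<in>I. outer (u i) (outer (v i) (w i))) =
      (\<Sum>r<card I. c (e r) *\<^sub>R outer (u' (e r)) (outer (v' (e r)) (w' (e r))))"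
    unfolding eq by (rule sum.reindex_bij_betw[OF e, symmetric])
  moreover have "(\<Sum>i\<in>I. c i) = (\<Sum>r<card I. \<bar>c (e r)\<bar>)"
    unfolding sum.reindex_bij_betw[OF e, symmetric] by (simp add: c_def)
  moreover have "\<forall>r<card I. norm (u' (e r)) = 1 \<and> norm (v' (e r)) = 1 \<and> norm (w' (e r)) = 1"
    using u' v' w' by blast
  ultimately show ?thesis
    unfolding decomposition_weights_def c_def[symmetric] mem_Collect_eq
    by (intro exI conjI)
qed

lemma bdd_below_decomposition_weights: "bdd_below (decomposition_weights T)"
  unfolding decomposition_weights_def by (rule bdd_belowI[of _ 0]) (auto simp: sum_nonneg)

lemma nuclear_norm_le_sum:
  assumes "finite I"
  shows "nuclear_norm (\<Sum>i\<in>I. outer (u i) (outer (v i) (w i)))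
    \<le> (\<Sum>i\<in>I. norm (u i) * (norm (v i) * norm (w i)))"
  unfolding nuclear_norm_eq
  using decomposition_weight_sum[OF assms] bdd_below_decomposition_weights by (rule cInf_lower)

text \<open>Every tensor is the sum of its fibres \<open>T $ i $ j\<close>, each placed by two axis
  vectors. Lower bounds on the infimum depend on this.\<close>

lemma decomposition_weights_nonempty: "decomposition_weights T \<noteq> {}"
  for T :: "('n1::finite, 'n2::finite, 'n3::finite) tensor"
proof -
  define I where "I = (UNIV :: ('n1 \<times> 'n2) set)"
  have "T = (\<Sum>(i, j)\<in>I. outer (axis i 1) (outer (axis j 1) (T $ i $ j)))"
  proof -
    have "(\<Sum>(i, j)\<in>I. outer (axis i 1) (outer (axis j 1) (T $ i $ j))) $ a $ b $ c
        = T $ a $ b $ c" for a b c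
    proof -
      have entry: "outer (axis i 1) (outer (axis j 1) z) $ a $ b $ c =
          (if i = a then if j = b then z $ c else 0 else 0)" for i j and z :: "real ^ 'n3"
        by (simp add: outer_def axis_def)
      have "(\<Sum>(i, j)\<in>I. outer (axis i 1) (outer (axis j 1) (T $ i $ j))) $ a $ b $ c
          = (\<Sum>i\<in>UNIV. \<Sum>j\<in>UNIV. outer (axis i 1) (outer (axis j 1) (T $ i $ j))) $ a $ b $ c"
        unfolding I_def by (simp add: sum.cartesian_product)
      also have "\<dots> = (\<Sum>i\<in>UNIV. \<Sum>j\<in>UNIV. if i = a then if j = b then T $ i $ j $ c else 0 else 0)"
        by (simp only: sum_component entry)
      also have "\<dots> = (\<Sum>i\<in>UNIV. if i = a then T $ i $ b $ c else 0)"
        by (intro sum.cong refl) simp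
      finally show ?thesis by simp
    qed
    then show ?thesis by (simp add: vec_eq_iff)
  qed
  then show ?thesis
    using decomposition_weight_sum[of I "\<lambda>(i, j). axis i 1" "\<lambda>(i, j). axis j 1" "\<lambda>(i, j). T $ i $ j"]
    by (auto simp: I_def case_prod_beta)
qed

section \<open>The semidefinite objective dominates the nuclear norm\<close>

text \<open>Factoring every \<open>\<Gamma> i\<close> turns \<open>T\<close> into a sum of rank-one
  tensors whose first factors \<open>x i\<close> have norm 1; the arithmetic-geometric mean
  inequality compares its weight with half the traces.\<close>

lemma nuclear_norm_le_sdp_objective:
  fixes x :: "'m::finite \<Rightarrow> real ^ 'n1::finite"
    and T :: "('n1::finite, 'n2::finite, 'n3::finite) tensor"
  assumes feas: "sdp_feasible A b x (T, \<Lambda>)" and unit: "\<And>i. norm (x i) = 1"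
  shows "nuclear_norm T \<le> sdp_objective (T, \<Lambda>)"
proof -
  obtain P \<Gamma> S where \<Lambda>: "\<And>i. \<Lambda> i = block_matrix (P i) (\<Gamma> i) (transpose (\<Gamma> i)) (S i)"
    and psd: "\<And>i. psd (\<Lambda> i)" and T: "T = (\<Sum>i\<in>UNIV. outer (x i) (\<Gamma> i))"
    using feas unfolding sdp_feasible_def prod.case by blast
  have "\<forall>i. \<exists>(R::nat) p q. \<Gamma> i = (\<Sum>k<R. outer (p k) (q k)) \<and>
      trace (\<Lambda> i) = (\<Sum>k<R. (norm (p k))\<^sup>2 + (norm (q k))\<^sup>2)"
  proof
    fix i
    show "\<exists>(R::nat) p q. \<Gamma> i = (\<Sum>k<R. outer (p k) (q k)) \<and>
        trace (\<Lambda> i) = (\<Sum>k<R. (norm (p k))\<^sup>2 + (norm (q k))\<^sup>2)"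
      using psd[of i] unfolding \<Lambda> by (rule psd_block_matrix_factor) blast
  qed
  then obtain R :: "'m \<Rightarrow> nat" and p q where factor: "\<forall>i. \<Gamma> i = (\<Sum>k<R i. outer (p i k) (q i k)) \<and>
      trace (\<Lambda> i) = (\<Sum>k<R i. (norm (p i k))\<^sup>2 + (norm (q i k))\<^sup>2)"
    unfolding choice_iff by (elim exE)
  then have \<Gamma>: "\<Gamma> i = (\<Sum>k<R i. outer (p i k) (q i k))"
    and tr: "trace (\<Lambda> i) = (\<Sum>k<R i. (norm (p i k))\<^sup>2 + (norm (q i k))\<^sup>2)" for i
    by auto
  \<comment> \<open>The number of factors depends on \<open>i\<close>, so the double sum is
    flattened to one over dependent pairs.\<close>
  let ?I = "SIGMA i:UNIV. {..<R i}"
  have "T = (\<Sum>i\<in>UNIV. \<Sum>k<R i. outer (x i) (outer (p i k) (q i k)))"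
    unfolding T \<Gamma> by (simp add: linear_sum[OF linear_outer_right])
  also have "\<dots> = (\<Sum>j\<in>?I. outer (x (fst j)) (outer (p (fst j) (snd j)) (q (fst j) (snd j))))"
    by (subst sum.Sigma) (auto simp: case_prod_beta)
  finally have "nuclear_norm T \<le>
      (\<Sum>j\<in>?I. norm (x (fst j)) * (norm (p (fst j) (snd j)) * norm (q (fst j) (snd j))))"
    by (auto intro!: nuclear_norm_le_sum finite_SigmaI)
  also have "\<dots> = (\<Sum>i\<in>UNIV. \<Sum>k<R i. norm (p i k) * norm (q i k))"
    by (subst sum.Sigma) (auto simp: case_prod_beta unit)
  also have "\<dots> \<le> (\<Sum>i\<in>UNIV. \<Sum>k<R i. 1/2 * ((norm (p i k))\<^sup>2 + (norm (q i k))\<^sup>2))"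
  proof (intro sum_mono)
    show "norm (p i k) * norm (q i k) \<le> 1/2 * ((norm (p i k))\<^sup>2 + (norm (q i k))\<^sup>2)" for i k
      using sum_squares_bound[of "norm (p i k)" "norm (q i k)"] by simp
  qed
  also have "\<dots> = sdp_objective (T, \<Lambda>)"
    by (simp add: sdp_objective_def tr sum_distrib_left flip: sum_divide_distrib)
  finally show ?thesis .
qed

section \<open>Feasible points from rank-one decompositions\<close>

text \<open>The diagonal blocks are free variables; filling them with the Gram sums of the
  \<open>p i k\<close> and of the \<open>q i k\<close> makes each block matrix a Gram sum, hence
  positive semidefinite.\<close>

lemma sdp_feasible_sum_outer:
  fixes x :: "'m::finite \<Rightarrow> real ^ 'n1::finite"
    and p :: "'m \<Rightarrow> 'i \<Rightarrow> real ^ 'n2::finite" and q :: "'m \<Rightarrow> 'i \<Rightarrow> real ^ 'n3::finite"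
  assumes "T = (\<Sum>i\<in>UNIV. outer (x i) (\<Sum>k\<in>I. outer (p i k) (q i k)))" and "meas_map A T = b"
  obtains \<Lambda> where "sdp_feasible A b x (T, \<Lambda>)"
    and "sdp_objective (T, \<Lambda>) = 1/2 * (\<Sum>i\<in>UNIV. \<Sum>k\<in>I. (norm (p i k))\<^sup>2 + (norm (q i k))\<^sup>2)"
proof
  let ?\<Lambda> = "\<lambda>i. \<Sum>k\<in>I. outer (join_vec (p i k) (q i k)) (join_vec (p i k) (q i k))"
  show "sdp_feasible A b x (T, ?\<Lambda>)"
    unfolding sdp_feasible_def prod.case
  proof (intro exI conjI allI)
    show "?\<Lambda> i = block_matrix (\<Sum>k\<in>I. outer (p i k) (p i k)) (\<Sum>k\<in>I. outer (p i k) (q i k))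
        (transpose (\<Sum>k\<in>I. outer (p i k) (q i k))) (\<Sum>k\<in>I. outer (q i k) (q i k))" for i
      by (rule sum_outer_join_vec)
    show "psd (?\<Lambda> i)" for i by (rule psd_sum_outer)
  qed (fact assms)+
  show "sdp_objective (T, ?\<Lambda>) =
      1/2 * (\<Sum>i\<in>UNIV. \<Sum>k\<in>I. (norm (p i k))\<^sup>2 + (norm (q i k))\<^sup>2)"
    by (simp add: sdp_objective_def trace_sum_outer norm_join_vec)
qed

text \<open>Let \<open>a\<close> be the normal of a hyperplane separating
  \<open>\<tau> *\<^sub>R u\<close> from the hull. The point \<open>y\<close> that hits the
  direction opposite to \<open>a\<close> satisfies
  \<open>a \<bullet> y \<le> - \<tau> * norm a\<close>, so it lies at least as far in that direction
  as \<open>\<tau> *\<^sub>R u\<close>.\<close>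

lemma hitting_set_convex_hull:
  assumes hit: "hitting_set \<tau> \<Upsilon>" and "0 < \<tau>" and "norm u = 1"
  shows "\<tau> *\<^sub>R u \<in> convex hull \<Upsilon>"
proof (rule ccontr)
  assume notin: "\<tau> *\<^sub>R u \<notin> convex hull \<Upsilon>"
  have fin: "finite \<Upsilon>" using hit by (simp add: hitting_set_def)
  then have "closed (convex hull \<Upsilon>)"
    by (simp add: compact_imp_closed finite_imp_compact_convex_hull)
  then obtain a \<beta> where a: "a \<bullet> (\<tau> *\<^sub>R u) < \<beta>" "\<And>y. y \<in> convex hull \<Upsilon> \<Longrightarrow> \<beta> < a \<bullet> y"
    using separating_hyperplane_closed_point[OF convex_convex_hull _ notin] by blast
  have hits: "\<exists>y\<in>\<Upsilon>. \<tau> \<le> z \<bullet> y" if "norm z = 1" for z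
  proof -
    have "z \<in> (\<Union>y\<in>\<Upsilon>. {z \<in> sphere 0 1. z \<bullet> y \<ge> \<tau>})"
      using hit that unfolding hitting_set_def by simp
    then show ?thesis by blast
  qed
  \<comment> \<open>With \<open>a = 0\<close>, any point of the hitting set would force both
    \<open>0 < \<beta>\<close> and \<open>\<beta> < 0\<close>.\<close>
  have "a \<noteq> 0"
  proof
    assume "a = 0"
    obtain y where "y \<in> \<Upsilon>" using hits[OF \<open>norm u = 1\<close>] by blast
    with a(1) a(2)[OF hull_inc] \<open>a = 0\<close> show False by fastforce
  qed
  then have "norm (- sgn a) = 1" by (simp add: norm_sgn)
  then obtain y where y: "y \<in> \<Upsilon>" "\<tau> \<le> - sgn a \<bullet> y" using hits by blast
  have "a \<bullet> y = norm a * (sgn a \<bullet> y)"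
    using \<open>a \<noteq> 0\<close> by (simp add: sgn_div_norm)
  also have "\<dots> \<le> norm a * - \<tau>"
    using y by (intro mult_left_mono) auto
  also have "\<dots> \<le> a \<bullet> (\<tau> *\<^sub>R u)"
  proof -
    have "- norm a \<le> a \<bullet> u"
      using Cauchy_Schwarz_ineq2[of a u] \<open>norm u = 1\<close> by simp
    then have "\<tau> * - norm a \<le> \<tau> * (a \<bullet> u)"
      using \<open>0 < \<tau>\<close> by (intro mult_left_mono) auto
    then show ?thesis by (simp add: mult.commute)
  qed
  finally show False
    using a(1) a(2)[OF hull_inc[OF y(1)]] by linarith
qed

text \<open>The family \<open>x\<close> may repeat points, so the weight of each point goes to one
  chosen preimage and all other indices get 0.\<close>

lemma convex_hull_range_coeffs:
  fixes x :: "'m::finite \<Rightarrow> 'a::real_vector"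
  assumes "y \<in> convex hull range x"
  obtains a where "\<And>i. a i \<ge> 0" "sum a UNIV = 1" "y = (\<Sum>i\<in>UNIV. a i *\<^sub>R x i)"
proof -
  obtain c where c: "\<And>z. z \<in> range x \<Longrightarrow> 0 \<le> c z" "sum c (range x) = 1"
    "(\<Sum>z\<in>range x. c z *\<^sub>R z) = y"
    using assms by (auto simp: convex_hull_finite)
  define J where "J = inv x ` range x"
  have inj: "inj_on (inv x) (range x)" by (simp add: inj_on_inv_into)
  define a where "a i = (if i \<in> J then c (x i) else 0)" for i
  have sum_J: "(\<Sum>i\<in>J. f (x i)) = sum f (range x)" for f :: "'a \<Rightarrow> 'b::comm_monoid_add"
    unfolding J_def by (simp add: sum.reindex[OF inj] f_inv_into_f)
  have "sum a UNIV = 1"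
    using c(2) sum_J[of c] by (simp add: a_def sum.If_cases)
  moreover have "(\<Sum>i\<in>UNIV. a i *\<^sub>R x i) = y"
    using c(3) sum_J[of "\<lambda>z. c z *\<^sub>R z"] by (simp add: a_def sum.If_cases if_distrib[of "\<lambda>t. t *\<^sub>R _"] cong: if_cong)
  moreover have "a i \<ge> 0" for i using c(1) by (simp add: a_def)
  ultimately show ?thesis using that by blast
qed

text \<open>Each \<open>\<tau> *\<^sub>R u r\<close> is a convex combination of the
  \<open>x i\<close>, which distributes the term \<open>r\<close> over the slices \<open>i\<close>.
  Balancing the norms of \<open>p\<close> and \<open>q\<close> makes the arithmetic-geometric mean
  inequality tight, so the cost is exactly \<open>s / \<tau>\<close>.\<close>

lemma sdp_feasible_from_decomposition:
  fixes x :: "'m::finite \<Rightarrow> real ^ 'n1::finite"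
    and T :: "('n1::finite, 'n2::finite, 'n3::finite) tensor"
  assumes hit: "hitting_set \<tau> (range x)" and \<tau>: "0 < \<tau>" and T: "meas_map A T = b"
    and s: "s \<in> decomposition_weights T"
  obtains \<Lambda> where "sdp_feasible A b x (T, \<Lambda>)" and "\<tau> * sdp_objective (T, \<Lambda>) = s"
proof -
  obtain R :: nat and c u v w
    where s_eq: "s = (\<Sum>r<R. \<bar>c r\<bar>)"
      and T_eq: "T = (\<Sum>r<R. c r *\<^sub>R outer (u r) (outer (v r) (w r)))"
      and unit: "\<And>r. r < R \<Longrightarrow> norm (u r) = 1 \<and> norm (v r) = 1 \<and> norm (w r) = 1"
    using s unfolding decomposition_weights_def by blast
  have "\<forall>r. \<exists>a. r < R \<longrightarrow>
      (\<forall>i. a i \<ge> 0) \<and> sum a UNIV = 1 \<and> \<tau> *\<^sub>R u r = (\<Sum>i\<in>UNIV. a i *\<^sub>R x i)"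
  proof (intro allI)
    fix r
    show "\<exists>a. r < R \<longrightarrow>
        (\<forall>i. a i \<ge> 0) \<and> sum a UNIV = 1 \<and> \<tau> *\<^sub>R u r = (\<Sum>i\<in>UNIV. a i *\<^sub>R x i)"
    proof (cases "r < R")
      case True
      then have "\<tau> *\<^sub>R u r \<in> convex hull range x"
        using hitting_set_convex_hull[OF hit \<tau>] unit by blast
      then show ?thesis by (rule convex_hull_range_coeffs) blast
    qed blast
  qed
  then obtain a where
    a: "\<forall>r. r < R \<longrightarrow> (\<forall>i. a r i \<ge> 0) \<and> sum (a r) UNIV = 1 \<and> \<tau> *\<^sub>R u r = (\<Sum>i\<in>UNIV. a r i *\<^sub>R x i)"
    unfolding choice_iff by (elim exE)
  have a_nonneg: "a r i \<ge> 0" and a_sum: "sum (a r) UNIV = 1"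
    and a_eq: "\<tau> *\<^sub>R u r = (\<Sum>i\<in>UNIV. a r i *\<^sub>R x i)" if "r < R" for r i
    using a that by auto
  \<comment> \<open>The share of the weight of term \<open>r\<close> that falls to
    \<open>x i\<close>. Its square root goes to both factors, and the sign of \<open>c r\<close> to
    \<open>q\<close> alone.\<close>
  define d where "d i r = \<bar>c r\<bar> * a r i / \<tau>" for i r
  define p where "p i r = sqrt (d i r) *\<^sub>R v r" for i r
  define q where "q i r = (sgn (c r) * sqrt (d i r)) *\<^sub>R w r" for i r
  have d_nonneg: "d i r \<ge> 0" if "r < R" for i r
    using a_nonneg[OF that] \<tau> by (simp add: d_def)
  have pq: "outer (p i r) (q i r) = (c r * a r i / \<tau>) *\<^sub>R outer (v r) (w r)" if "r < R" for i r
  proof -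
    have "outer (p i r) (q i r) = (sgn (c r) * (sqrt (d i r) * sqrt (d i r))) *\<^sub>R outer (v r) (w r)"
      by (simp add: p_def q_def outer_def vec_eq_iff)
    also have "sgn (c r) * (sqrt (d i r) * sqrt (d i r)) = c r * a r i / \<tau>"
      using real_sqrt_mult_self[of "d i r"] d_nonneg[OF that, of i]
      by (simp only: abs_of_nonneg) (simp add: d_def sgn_mult_abs flip: mult.assoc)
    finally show ?thesis .
  qed
  \<comment> \<open>If \<open>c r = 0\<close>, then \<open>sgn (c r)\<close> is not a unit, but
    \<open>d i r\<close> vanishes as well.\<close>
  have norm_pq: "(norm (p i r))\<^sup>2 + (norm (q i r))\<^sup>2 = 2 * d i r" if "r < R" for i r
    using unit[OF that] d_nonneg[OF that, of i]
    by (cases "c r = 0") (simp_all add: p_def q_def power_mult_distrib sgn_if, simp add: d_def)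
  have "T = (\<Sum>r<R. \<Sum>i\<in>UNIV. outer (x i) (outer (p i r) (q i r)))"
    unfolding T_eq
  proof (intro sum.cong refl)
    fix r assume "r \<in> {..<R}"
    then have r: "r < R" by simp
    have "u r = (1 / \<tau>) *\<^sub>R (\<tau> *\<^sub>R u r)" using \<tau> by simp
    also have "\<dots> = (\<Sum>i\<in>UNIV. (a r i / \<tau>) *\<^sub>R x i)"
      unfolding a_eq[OF r] by (simp add: scaleR_sum_right)
    finally have "c r *\<^sub>R outer (u r) (outer (v r) (w r)) =
        c r *\<^sub>R outer (\<Sum>i\<in>UNIV. (a r i / \<tau>) *\<^sub>R x i) (outer (v r) (w r))"
      by simp
    also have "\<dots> = (\<Sum>i\<in>UNIV. outer (x i) (outer (p i r) (q i r)))"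
      by (simp add: pq[OF r] linear_sum[OF linear_outer_left] linear_cmul[OF linear_outer_left]
          linear_cmul[OF linear_outer_right] scaleR_sum_right)
    finally show "c r *\<^sub>R outer (u r) (outer (v r) (w r)) =
        (\<Sum>i\<in>UNIV. outer (x i) (outer (p i r) (q i r)))" .
  qed
  also have "\<dots> = (\<Sum>i\<in>UNIV. outer (x i) (\<Sum>r<R. outer (p i r) (q i r)))"
    by (subst sum.swap) (simp add: linear_sum[OF linear_outer_right])
  finally obtain \<Lambda> where \<Lambda>: "sdp_feasible A b x (T, \<Lambda>)"
    and obj: "sdp_objective (T, \<Lambda>) = 1/2 * (\<Sum>i\<in>UNIV. \<Sum>r<R. (norm (p i r))\<^sup>2 + (norm (q i r))\<^sup>2)"
    using T by (rule sdp_feasible_sum_outer)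
  have "sdp_objective (T, \<Lambda>) = (\<Sum>i\<in>UNIV. \<Sum>r<R. d i r)"
    unfolding obj by (simp add: norm_pq sum_distrib_left)
  also have "\<dots> = (\<Sum>r<R. \<Sum>i\<in>UNIV. d i r)" by (rule sum.swap)
  also have "\<dots> = (\<Sum>r<R. \<bar>c r\<bar> / \<tau>)"
    by (intro sum.cong refl)
       (simp add: d_def a_sum flip: sum_distrib_left sum_divide_distrib)
  also have "\<dots> = s / \<tau>" by (simp add: s_eq sum_divide_distrib)
  finally have "\<tau> * sdp_objective (T, \<Lambda>) = s" using \<tau> by simp
  with \<Lambda> show ?thesis using that by blast
qed

section \<open>Approximation bounds\<close>

theorem theorem3:
  fixes A :: "'d::finite \<Rightarrow> ('n1::finite, 'n2::finite, 'n3::finite) tensor"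
    and b :: "real ^ 'd"
    and T_opt T_hat :: "('n1, 'n2, 'n3) tensor"
    and \<tau> V_hat :: real
    and \<Upsilon> :: "(real ^ 'n1) set"
    and x :: "'m::finite \<Rightarrow> real ^ 'n1"
    and \<Lambda>_hat :: "'m \<Rightarrow> real ^ ('n2 + 'n3) ^ ('n2 + 'n3)"
  assumes "inj A" and "independent (range A)"
    and "{T. meas_map A T = b} \<noteq> {}"
    and "is_arg_min nuclear_norm (\<lambda>T. meas_map A T = b) T_opt"
    and "0 < \<tau>" and "\<tau> \<le> 1"
    and "\<Upsilon> = range x" and "hitting_set \<tau> \<Upsilon>"
    and "is_arg_min sdp_objective (sdp_feasible A b x) (T_hat, \<Lambda>_hat)"
    and "V_hat = sdp_value A b x"
  shows "\<tau> * V_hat \<le> nuclear_norm T_hat \<and> nuclear_norm T_hat \<le> V_hat \<and>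
         \<tau> * nuclear_norm T_hat \<le> nuclear_norm T_opt \<and> nuclear_norm T_opt \<le> nuclear_norm T_hat"
proof -
  have hit: "hitting_set \<tau> (range x)" using assms by simp
  have feas_hat: "sdp_feasible A b x (T_hat, \<Lambda>_hat)"
    and min_hat: "\<And>y. sdp_feasible A b x y \<Longrightarrow> sdp_objective (T_hat, \<Lambda>_hat) \<le> sdp_objective y"
    using assms(9) by (auto simp: is_arg_min_linorder)
  \<comment> \<open>The infimum defining \<open>sdp_value\<close> is attained at the given optimal
    solution.\<close>
  have V_hat: "V_hat = sdp_objective (T_hat, \<Lambda>_hat)"
    unfolding assms(10) sdp_value_def
    by (rule cInf_eq_minimum) (use feas_hat min_hat in auto)
  \<comment> \<open>Proved for every tensor meeting the constraints, because it is applied to both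
    \<open>T_hat\<close> and \<open>T_opt\<close>. Each weight of \<open>T\<close> yields a feasible
    point, whose objective is at least \<open>V_hat\<close>.\<close>
  have lower: "\<tau> * V_hat \<le> nuclear_norm T" if "meas_map A T = b" for T
    unfolding nuclear_norm_eq
  proof (rule cInf_greatest[OF decomposition_weights_nonempty])
    fix s assume "s \<in> decomposition_weights T"
    then obtain \<Lambda> where "sdp_feasible A b x (T, \<Lambda>)" and "\<tau> * sdp_objective (T, \<Lambda>) = s"
      using sdp_feasible_from_decomposition[OF hit \<open>0 < \<tau>\<close> \<open>meas_map A T = b\<close>] by blast
    then show "\<tau> * V_hat \<le> s"
      using min_hat \<open>0 < \<tau>\<close> unfolding V_hat by (metis mult_left_mono less_imp_le)
  qed
  have meas_hat: "meas_map A T_hat = b"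
    using feas_hat by (auto simp: sdp_feasible_def)
  have "norm (x i) = 1" for i
    using hit by (auto simp: hitting_set_def)
  then have upper: "nuclear_norm T_hat \<le> V_hat"
    unfolding V_hat by (rule nuclear_norm_le_sdp_objective[OF feas_hat])
  have meas_opt: "meas_map A T_opt = b"
    and min_opt: "nuclear_norm T_opt \<le> nuclear_norm T_hat"
    using assms(4) meas_hat by (auto simp: is_arg_min_linorder)
  have "\<tau> * nuclear_norm T_hat \<le> \<tau> * V_hat"
    using upper \<open>0 < \<tau>\<close> by simp
  with lower[OF meas_opt] have "\<tau> * nuclear_norm T_hat \<le> nuclear_norm T_opt"
    by linarith
  with lower[OF meas_hat] upper min_opt show ?thesis by blast
qed

end
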